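(* Suppose the DAE $\dot y=f(y,z,t)$, $0=g(y,z,t)$ is semi-explicit index-1 with true solution $[y,z]^T$, and let $[Y,Z]^T$ be its numerical solution. Let $(\phi^{(y)},\phi^{(z)})$ solve the adjoint problem $$-\dot{\phi}^{(y)}=\bar f_y^T\phi^{(y)}+\bar g_y^T\phi^{(z)}+\psi^y,\qquad 0=\bar f_z^T\phi^{(y)}+\bar g_z^T\phi^{(z)}+\psi^z,\qquad t\in[0,T),$$ with $\phi^{(y)}(T)=0$. Then the error $e^{\mathcal{Q}_{[0,T]}}=\langle e^{(y)},\psi^y\rangle+\langle e^{(z)},\psi^z\rangle$ in the computed quantity of interest $\mathcal{Q}_{[0,T]}(Y,Z)$ is $$e^{\mathcal{Q}_{[0,T]}}=\big(\phi^{(y)}(0),e^{(y)}(0)\big)+\langle\phi^{(y)},f(Y,Z)-\dot Y\rangle+\langle\phi^{(z)},g(Y,Z)\rangle.$$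
   Context: Setting: $y(t)\in\mathbb{R}^n$, $z(t)\in\mathbb{R}^m$, $t\in[0,T]$; $f$ takes values in $\mathbb{R}^n$, $g$ in $\mathbb{R}^m$, both smooth enough that all derivatives that appear exist and are continuous. The DAE is index-1 if $g_z=\partial g/\partial z$ is invertible in a neighborhood of the solution. Explicit dependence on $t$ is suppressed: $f(Y,Z)$ means $f(Y(t),Z(t),t)$, etc. Numerical solution: with $t_k=k\Delta t$, $\Delta t=T/N$, $Y_0=y(0)$, $Z_0=z(0)$, the values satisfy the BDF-1 (implicit Euler) equations $Y_{k+1}=Y_k+\Delta t\,f(Y_{k+1},Z_{k+1},t_{k+1})$, $0=g(Y_{k+1},Z_{k+1},t_{k+1})$, $k=0,\dots,N-1$. $Y(t),Z(t)$ are the continuous piecewise linear interpolants of these values. The derivative $\dot Y$ is taken piecewise. $e^{(y)}=y-Y$, $e^{(z)}=z-Z$. $(\cdot,\cdot)$ is the Euclidean inner product and $\langle a,b\rangle=\int_0^T(a(t),b(t))\,dt$. For given $\psi^y\in[L^2(0,T)]^n$, $\psi^z\in[L^2(0,T)]^m$, $\mathcal{Q}_{[0,T]}(y,z)=\langle y,\psi^y\rangle+\langle z,\psi^z\rangle$ and $e^{\mathcal{Q}_{[0,T]}}=\mathcal{Q}_{[0,T]}(y,z)-\mathcal{Q}_{[0,T]}(Y,Z)$. Linearized operators (functions of $t$): $\bar f_y=\int_0^1\frac{\partial f}{\partial y}(\tilde y,\tilde z,t)ds$, $\bar f_z=\int_0^1\frac{\partial f}{\partial z}(\tilde y,\tilde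 z,t)ds$, $\bar g_y=\int_0^1\frac{\partial g}{\partial y}(\tilde y,\tilde z,t)ds$, $\bar g_z=\int_0^1\frac{\partial g}{\partial z}(\tilde y,\tilde z,t)ds$, with $\tilde y=sy+(1-s)Y$, $\tilde z=sz+(1-s)Z$. Adjoint variables: $\phi^{(y)}(t)\in\mathbb{R}^n$ is continuous on $[0,T]$ (absolutely continuous, equations holding for almost every $t$), $\phi^{(z)}(t)\in\mathbb{R}^m$ is square integrable. $\phi^{(z)}(T)$ is the consistent value $-[\bar g_z^T]^{-1}[\bar f_z^T\phi^{(y)}+\psi^z]|_{t=T}$. The numerical solution is assumed close enough to the true one that $\bar g_z$ is invertible. *)

theory Defs
  imports "HOL-Analysis.Analysis"
begin

text \<open>
  A right-hand side is a function of \<open>(y, z, t)\<close> with \<open>y\<close> in R^n, \<open>z\<close> in R^m. It is only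
  required to be meaningful on a domain \<open>\<Omega>\<close>, a relatively open subset of
  \<open>R^n \<times> R^m \<times> [0,T]\<close>; the case of globally defined functions is
  \<open>\<Omega> = UNIV \<times> UNIV \<times> {0..T}\<close>.
\<close>

definition partial_y ::
  "(real^'n \<Rightarrow> real^'m \<Rightarrow> real \<Rightarrow> real^'k) \<Rightarrow> real^'n \<Rightarrow> real^'m \<Rightarrow> real \<Rightarrow> real^'n^'k" where
  "partial_y F u v t = jacobian (\<lambda>u'. F u' v t) (at u)"

definition partial_z ::
  "(real^'n \<Rightarrow> real^'m \<Rightarrow> real \<Rightarrow> real^'k) \<Rightarrow> real^'n \<Rightarrow> real^'m \<Rightarrow> real \<Rightarrow> real^'m^'k" where
  "partial_z F u v t = jacobian (\<lambda>v'. F u v' t) (at v)"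

definition dae_domain :: "real \<Rightarrow> ((real^'n) \<times> (real^'m) \<times> real) set \<Rightarrow> bool" where
  "dae_domain T \<Omega> \<longleftrightarrow> openin (top_of_set (UNIV \<times> UNIV \<times> {0..T})) \<Omega>"

text \<open>
  Only the derivatives with respect to \<open>y\<close> and \<open>z\<close> are needed; no differentiability in \<open>t\<close> is
  imposed.
\<close>

definition smooth_rhs ::
  "((real^'n) \<times> (real^'m) \<times> real) set \<Rightarrow> (real^'n \<Rightarrow> real^'m \<Rightarrow> real \<Rightarrow> real^'k) \<Rightarrow> bool" where
  "smooth_rhs \<Omega> F \<longleftrightarrow>
     continuous_on \<Omega> (\<lambda>(u, v, t). F u v t) \<and>
     (\<forall>(u, v, t) \<in> \<Omega>. (\<lambda>u'. F u' v t) differentiable (at u) \<and>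
                      (\<lambda>v'. F u v' t) differentiable (at v)) \<and>
     continuous_on \<Omega> (\<lambda>(u, v, t). partial_y F u v t) \<and>
     continuous_on \<Omega> (\<lambda>(u, v, t). partial_z F u v t)"

definition dae_solution ::
  "real \<Rightarrow> ((real^'n) \<times> (real^'m) \<times> real) set \<Rightarrow>
   (real^'n \<Rightarrow> real^'m \<Rightarrow> real \<Rightarrow> real^'n) \<Rightarrow> (real^'n \<Rightarrow> real^'m \<Rightarrow> real \<Rightarrow> real^'m) \<Rightarrow>
   (real \<Rightarrow> real^'n) \<Rightarrow> (real \<Rightarrow> real^'m) \<Rightarrow> bool" where
  "dae_solution T \<Omega> f g y z \<longleftrightarrow>
     continuous_on {0..T} z \<and>
     (\<forall>t\<in>{0..T}. (y t, z t, t) \<in> \<Omega> \<and>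
        (y has_vector_derivative f (y t) (z t) t) (at t within {0..T}) \<and>
        0 = g (y t) (z t) t)"

definition index_1 ::
  "real \<Rightarrow> ((real^'n) \<times> (real^'m) \<times> real) set \<Rightarrow> (real^'n \<Rightarrow> real^'m \<Rightarrow> real \<Rightarrow> real^'m) \<Rightarrow>
   (real \<Rightarrow> real^'n) \<Rightarrow> (real \<Rightarrow> real^'m) \<Rightarrow> bool" where
  "index_1 T \<Omega> g y z \<longleftrightarrow>
     (\<exists>U. openin (top_of_set (UNIV \<times> UNIV \<times> {0..T})) U \<and> U \<subseteq> \<Omega> \<and>
          (\<forall>t\<in>{0..T}. (y t, z t, t) \<in> U) \<and>
          (\<forall>(u, v, t) \<in> U. invertible (partial_z g u v t)))"

definition bdf1 ::
  "real \<Rightarrow> nat \<Rightarrow>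
   (real^'n \<Rightarrow> real^'m \<Rightarrow> real \<Rightarrow> real^'n) \<Rightarrow> (real^'n \<Rightarrow> real^'m \<Rightarrow> real \<Rightarrow> real^'m) \<Rightarrow>
   (nat \<Rightarrow> real^'n) \<Rightarrow> (nat \<Rightarrow> real^'m) \<Rightarrow> bool" where
  "bdf1 T N f g Yn Zn \<longleftrightarrow>
     (let dt = T / real N in
      \<forall>k<N. Yn (Suc k) = Yn k + dt *\<^sub>R f (Yn (Suc k)) (Zn (Suc k)) (real (Suc k) * dt) \<and>
            0 = g (Yn (Suc k)) (Zn (Suc k)) (real (Suc k) * dt))"

definition pw_linear_interpolant ::
  "real \<Rightarrow> nat \<Rightarrow> (nat \<Rightarrow> 'a::real_vector) \<Rightarrow> (real \<Rightarrow> 'a) \<Rightarrow> bool" where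
  "pw_linear_interpolant T N Xn X \<longleftrightarrow>
     (let dt = T / real N in
      \<forall>k<N. \<forall>t \<in> {real k * dt .. real (Suc k) * dt}.
        X t = Xn k + ((t - real k * dt) / dt) *\<^sub>R (Xn (Suc k) - Xn k))"

definition ip_T :: "real \<Rightarrow> (real \<Rightarrow> 'a::euclidean_space) \<Rightarrow> (real \<Rightarrow> 'a) \<Rightarrow> real" where
  "ip_T T a b = set_lebesgue_integral lebesgue {0..T} (\<lambda>t. a t \<bullet> b t)"

definition L2_T :: "real \<Rightarrow> (real \<Rightarrow> 'a::euclidean_space) \<Rightarrow> bool" where
  "L2_T T a \<longleftrightarrow> set_borel_measurable lebesgue {0..T} a \<and>
                set_integrable lebesgue {0..T} (\<lambda>t. (norm (a t))\<^sup>2)"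

definition qoi ::
  "real \<Rightarrow> (real \<Rightarrow> real^'n) \<Rightarrow> (real \<Rightarrow> real^'m) \<Rightarrow> (real \<Rightarrow> real^'n) \<Rightarrow> (real \<Rightarrow> real^'m) \<Rightarrow> real" where
  "qoi T \<psi>y \<psi>z y z = ip_T T y \<psi>y + ip_T T z \<psi>z"

definition segment_in ::
  "real \<Rightarrow> ((real^'n) \<times> (real^'m) \<times> real) set \<Rightarrow> (real \<Rightarrow> real^'n) \<Rightarrow> (real \<Rightarrow> real^'m) \<Rightarrow>
   (real \<Rightarrow> real^'n) \<Rightarrow> (real \<Rightarrow> real^'m) \<Rightarrow> bool" where
  "segment_in T \<Omega> y z Y Z \<longleftrightarrow>
     (\<forall>t\<in>{0..T}. \<forall>s\<in>{0..1}.
        (s *\<^sub>R y t + (1 - s) *\<^sub>R Y t, s *\<^sub>R z t + (1 - s) *\<^sub>R Z t, t) \<in> \<Omega>)"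

definition avg_y ::
  "(real^'n \<Rightarrow> real^'m \<Rightarrow> real \<Rightarrow> real^'k) \<Rightarrow> (real \<Rightarrow> real^'n) \<Rightarrow> (real \<Rightarrow> real^'m) \<Rightarrow>
   (real \<Rightarrow> real^'n) \<Rightarrow> (real \<Rightarrow> real^'m) \<Rightarrow> real \<Rightarrow> real^'n^'k" where
  "avg_y F y z Y Z t =
     integral {0..1} (\<lambda>s. partial_y F (s *\<^sub>R y t + (1 - s) *\<^sub>R Y t) (s *\<^sub>R z t + (1 - s) *\<^sub>R Z t) t)"

definition avg_z ::
  "(real^'n \<Rightarrow> real^'m \<Rightarrow> real \<Rightarrow> real^'k) \<Rightarrow> (real \<Rightarrow> real^'n) \<Rightarrow> (real \<Rightarrow> real^'m) \<Rightarrow>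
   (real \<Rightarrow> real^'n) \<Rightarrow> (real \<Rightarrow> real^'m) \<Rightarrow> real \<Rightarrow> real^'m^'k" where
  "avg_z F y z Y Z t =
     integral {0..1} (\<lambda>s. partial_z F (s *\<^sub>R y t + (1 - s) *\<^sub>R Y t) (s *\<^sub>R z t + (1 - s) *\<^sub>R Z t) t)"

text \<open>
  Absolute continuity of a function on a real interval (unrelated to the library's absolute
  continuity of measures). A division consists of finitely many nonoverlapping nonempty compact
  intervals, so \<open>Inf k\<close> and \<open>Sup k\<close> are the end points of \<open>k\<close>; the divided set \<open>S\<close> need not be an
  interval.
\<close>

definition abs_continuous_on_interval :: "real \<Rightarrow> real \<Rightarrow> (real \<Rightarrow> 'a::real_normed_vector) \<Rightarrow> bool" where
  "abs_continuous_on_interval a b F \<longleftrightarrow>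
     (\<forall>\<epsilon>>0. \<exists>\<delta>>0. \<forall>d S. d division_of S \<and> S \<subseteq> {a..b} \<and> (\<Sum>k\<in>d. Sup k - Inf k) < \<delta> \<longrightarrow>
        (\<Sum>k\<in>d. norm (F (Sup k) - F (Inf k))) < \<epsilon>)"

text \<open>
  The equations hold for almost every \<open>t\<close>. The last conjunct fixes the value of the
  square-integrable component at the end point, where the algebraic equation is imposed pointwise.
\<close>

definition adjoint_solution ::
  "real \<Rightarrow>
   (real^'n \<Rightarrow> real^'m \<Rightarrow> real \<Rightarrow> real^'n) \<Rightarrow> (real^'n \<Rightarrow> real^'m \<Rightarrow> real \<Rightarrow> real^'m) \<Rightarrow>
   (real \<Rightarrow> real^'n) \<Rightarrow> (real \<Rightarrow> real^'m) \<Rightarrow> (real \<Rightarrow> real^'n) \<Rightarrow> (real \<Rightarrow> real^'m) \<Rightarrow>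
   (real \<Rightarrow> real^'n) \<Rightarrow> (real \<Rightarrow> real^'m) \<Rightarrow> (real \<Rightarrow> real^'n) \<Rightarrow> (real \<Rightarrow> real^'m) \<Rightarrow> bool" where
  "adjoint_solution T f g y z Y Z \<psi>y \<psi>z \<phi>y \<phi>z \<longleftrightarrow>
     abs_continuous_on_interval 0 T \<phi>y \<and> L2_T T \<phi>z \<and>
     (AE t in lebesgue. t \<in> {0..<T} \<longrightarrow>
        (\<phi>y has_vector_derivative
           - (transpose (avg_y f y z Y Z t) *v \<phi>y t + transpose (avg_y g y z Y Z t) *v \<phi>z t + \<psi>y t))
          (at t within {0..T})) \<and>
     (AE t in lebesgue. t \<in> {0..<T} \<longrightarrow>
        0 = transpose (avg_z f y z Y Z t) *v \<phi>y t + transpose (avg_z g y z Y Z t) *v \<phi>z t + \<psi>z t) \<and>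
     \<phi>y T = 0 \<and>
     \<phi>z T = - (matrix_inv (transpose (avg_z g y z Y Z T)) *v
               (transpose (avg_z f y z Y Z T) *v \<phi>y T + \<psi>z T))"

end

theory Submission
  imports Defs
begin

text \<open>
  The error formula is a duality argument. Write \<open>ey = y - Y\<close> and \<open>ez = z - Z\<close>. Integrating the
  derivatives of \<open>f\<close> and \<open>g\<close> along the segment from the numerical to the true solution gives, with
  no remainder,
  \<open>f(y,z) - f(Y,Z) = avg_y f ey + avg_z f ez\<close> and \<open>- g(Y,Z) = avg_y g ey + avg_z g ez\<close>
  (\<open>rhs_diff_eq_avg_mult\<close>). The adjoint problem is built from the transposes of exactly these
  averaged matrices. Hence, when \<open>\<phi>y \<bullet> ey\<close> is differentiated and both adjoint equations are
  inserted, all matrices cancel, and for almost every \<open>t\<close>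
  \<open>(\<phi>y \<bullet> ey)' = \<phi>y \<bullet> (f(Y,Z) - Y') + \<phi>z \<bullet> g(Y,Z) - ey \<bullet> \<psi>y - ez \<bullet> \<psi>z\<close>.
  Integrating over \<open>[0,T]\<close> and using \<open>\<phi>y(T) = 0\<close> yields the formula.

  The delicate point is the last integration, because \<open>\<phi>y\<close> is only absolutely continuous and \<open>Y\<close>
  has kinks. The product \<open>\<phi>y \<bullet> ey\<close> is absolutely continuous, since \<open>ey\<close> is Lipschitz
  (\<open>abs_continuous_on_interval_inner_lipschitz\<close>), and for such functions the fundamental theorem of
  calculus tolerates a null set of points without a derivative
  (\<open>fundamental_theorem_of_calculus_abs_continuous\<close>).
\<close>

section \<open>Absolutely continuous functions\<close>

text \<open>
  Turns smallness in Lebesgue measure into the smallness of a total length that absolute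
  continuity asks for. Only overlaps of measure zero are possible, so the lengths add up to the
  measure of the union.
\<close>

lemma sum_lengths_division_le_measure:
  fixes S U :: "real set"
  assumes d: "d division_of S" and "S \<subseteq> U" and U: "U \<in> lmeasurable"
  shows "(\<Sum>K\<in>d. Sup K - Inf K) \<le> measure lebesgue U"
proof -
  note D = division_ofD[OF d]
  have "(\<Sum>K\<in>d. Sup K - Inf K) = (\<Sum>K\<in>d. measure lebesgue K)"
  proof (rule sum.cong[OF refl])
    fix K assume "K \<in> d"
    then obtain a b where "K = {a..b}" "K \<noteq> {}" using D(3,4) by (metis box_real(2))
    then show "Sup K - Inf K = measure lebesgue K" by auto
  qed
  also have "\<dots> = measure lebesgue (\<Union>d)"
  proof (rule measure_negligible_finite_Union[symmetric])
    show "pairwise (\<lambda>K L. negligible (K \<inter> L)) d"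
    proof (rule pairwiseI)
      fix K L assume KL: "K \<in> d" "L \<in> d" "K \<noteq> L"
      then have "convex (K \<inter> L)" "interior (K \<inter> L) = {}"
        using D(4)[OF KL(1)] D(4)[OF KL(2)] D(5)[OF KL] by (auto intro!: convex_Int)
      then show "negligible (K \<inter> L)" by (simp add: negligible_convex_interior)
    qed
    show "K \<in> lmeasurable" if "K \<in> d" for K using D(4)[OF that] by auto
  qed (fact D(1))
  also have "\<dots> \<le> measure lebesgue U"
    using \<open>S \<subseteq> U\<close> D(6) U fmeasurableD[OF lmeasurable_division[OF d]]
    by (intro measure_mono_fmeasurable) auto
  finally show ?thesis .
qed

text \<open>
  Integrability of the derivative comes out of the argument, which works directly with gauges. For a
  tag outside \<open>E\<close> the gauge comes from differentiability at the tag, as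
  for an everywhere differentiable function. For a tag in \<open>E\<close> it is an open set \<open>U \<supseteq> E\<close> of small
  measure: the intervals so tagged have small total length, hence by absolute continuity the
  increments of \<open>F\<close> over them are negligible. On \<open>E\<close> the integrand is replaced by \<open>0\<close>, so that these
  tags add nothing to the Riemann sum.
\<close>

lemma fundamental_theorem_of_calculus_abs_continuous:
  fixes F :: "real \<Rightarrow> 'a::banach"
  assumes "a \<le> b" and F: "abs_continuous_on_interval a b F" and E: "negligible E"
    and deriv: "\<And>x. x \<in> {a..b} - E \<Longrightarrow> (F has_vector_derivative F' x) (at x within {a..b})"
  shows "(F' has_integral (F b - F a)) {a..b}"
proof -
  define G where "G x = (if x \<in> E then 0 else F' x)" for x
  have "(G has_integral (F b - F a)) {a..b}"
    unfolding has_integral_real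
  proof (intro allI impI)
    fix e :: real assume "e > 0"
    \<comment> \<open>half of the error is spent off \<open>E\<close>, in proportion to length; the summand 2 in the
      denominator covers \<open>a = b\<close>\<close>
    define \<eta> where "\<eta> = e / (2 * (b - a) + 2)"
    have "\<eta> > 0" using \<open>a \<le> b\<close> \<open>e > 0\<close> by (simp add: \<eta>_def)
    have \<eta>: "\<eta> * (b - a) < e / 2"
      using \<open>a \<le> b\<close> \<open>e > 0\<close> by (simp add: \<eta>_def field_simps)
    have "\<forall>x. \<exists>d>0. x \<in> {a..b} - E \<longrightarrow>
        (\<forall>y\<in>{a..b}. norm (y - x) < d \<longrightarrow> norm (F y - F x - (y - x) *\<^sub>R F' x) \<le> \<eta> * norm (y - x))"
      using deriv[unfolded has_vector_derivative_def has_derivative_within_alt] \<open>\<eta> > 0\<close>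
      by (metis zero_less_one)
    then obtain r where r: "\<And>x. 0 < r x"
      "\<And>x y. \<lbrakk>x \<in> {a..b} - E; y \<in> {a..b}; norm (y - x) < r x\<rbrakk>
            \<Longrightarrow> norm (F y - F x - (y - x) *\<^sub>R F' x) \<le> \<eta> * norm (y - x)"
      by metis
    obtain \<delta> where "\<delta> > 0" and \<delta>:
      "\<forall>d S. d division_of S \<and> S \<subseteq> {a..b} \<and> (\<Sum>K\<in>d. Sup K - Inf K) < \<delta> \<longrightarrow>
        (\<Sum>K\<in>d. norm (F (Sup K) - F (Inf K))) < e / 2"
      using F half_gt_zero[OF \<open>e > 0\<close>] unfolding abs_continuous_on_interval_def by blast
    obtain U where U: "open U" "E \<subseteq> U" "U \<in> lmeasurable" "measure lebesgue U < \<delta>"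
    proof -
      have "E \<in> sets lebesgue" using E by (rule negligible_imp_sets)
      then obtain U where U: "open U" "E \<subseteq> U" "U - E \<in> lmeasurable"
        "emeasure lebesgue (U - E) < ennreal \<delta>"
        using sets_lebesgue_outer_open \<open>\<delta> > 0\<close> by metis
      have "U \<in> lmeasurable"
        using U(2,3) E by (metis Diff_partition fmeasurable.Un negligible_imp_measurable)
      moreover have "measure lebesgue U = measure lebesgue (U - E)"
        using E U(1) by (simp add: measure_Diff_null_set negligible_iff_null_sets)
      moreover have "measure lebesgue (U - E) < \<delta>"
        using U(3,4) \<open>\<delta> > 0\<close> by (simp add: emeasure_eq_measure2 ennreal_less_iff)
      ultimately show thesis using that U by metis
    qed
    define \<gamma> where "\<gamma> x = (if x \<in> E then U else ball x (r x))" for x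
    have "gauge \<gamma>" using U r(1) by (auto simp: gauge_def \<gamma>_def)
    moreover have "norm ((\<Sum>(x, K)\<in>p. measure lborel K *\<^sub>R G x) - (F b - F a)) < e"
      if p: "p tagged_division_of {a..b}" and fine: "\<gamma> fine p" for p
    proof -
      define q where "q = {(x, K) \<in> p. x \<in> E}"
      define \<Delta> where "\<Delta> K = F (Sup K) - F (Inf K)" for K :: "real set"
      have "finite p" using p by auto
      have "q \<subseteq> p" by (auto simp: q_def)
      then have q: "q tagged_partial_division_of {a..b}"
        using p by (metis tagged_division_of_def tagged_partial_division_subset)
      have bound: "norm (measure lborel K *\<^sub>R G x - \<Delta> K)
          \<le> \<eta> * (Sup K - Inf K) + (if x \<in> E then norm (\<Delta> K) else 0)" if xK: "(x, K) \<in> p" for x K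
      proof -
        obtain u v where K: "K = {u..v}" "x \<in> K" "K \<subseteq> {a..b}"
          using tagged_division_ofD(2-4)[OF p xK] by auto
        then have uv: "u \<le> x" "x \<le> v" "u \<in> {a..b}" "v \<in> {a..b}" by auto
        show ?thesis
        proof (cases "x \<in> E")
          case True
          then show ?thesis using K uv \<open>\<eta> > 0\<close> by (simp add: G_def)
        next
          case False
          then have "K \<subseteq> ball x (r x)" using fineD[OF fine xK] by (simp add: \<gamma>_def)
          then have uv': "norm (u - x) < r x" "norm (v - x) < r x"
            using uv K(1) by (auto simp: dist_real_def dest: subsetD[of _ _ u] subsetD[of _ _ v])
          have x: "x \<in> {a..b} - E" using False K by auto
          have "norm (measure lborel K *\<^sub>R G x - \<Delta> K)
              = norm ((F u - F x - (u - x) *\<^sub>R F' x) - (F v - F x - (v - x) *\<^sub>R F' x))"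
            using K(1) uv False by (simp add: G_def \<Delta>_def algebra_simps)
          also have "\<dots> \<le> \<eta> * norm (u - x) + \<eta> * norm (v - x)"
            by (intro norm_triangle_le_diff add_mono r(2) x uv uv')
          also have "\<dots> = \<eta> * (Sup K - Inf K)" using K(1) uv by (simp add: algebra_simps)
          finally show ?thesis using False by simp
        qed
      qed
      have len: "(\<Sum>(x, K)\<in>p. Sup K - Inf K) = b - a" and sumF: "(\<Sum>(x, K)\<in>p. \<Delta> K) = F b - F a"
        using additive_tagged_division_1[OF \<open>a \<le> b\<close> p, of "\<lambda>x. x"]
          additive_tagged_division_1[OF \<open>a \<le> b\<close> p, of F] by (simp_all add: \<Delta>_def)
      have "norm ((\<Sum>(x, K)\<in>p. measure lborel K *\<^sub>R G x) - (F b - F a))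
          = norm (\<Sum>(x, K)\<in>p. measure lborel K *\<^sub>R G x - \<Delta> K)"
        by (simp add: sumF[symmetric] sum_subtractf case_prod_unfold)
      also have "\<dots> \<le> (\<Sum>(x, K)\<in>p. \<eta> * (Sup K - Inf K) + (if x \<in> E then norm (\<Delta> K) else 0))"
        by (rule sum_norm_le) (use bound in auto)
      also have "\<dots> = \<eta> * (b - a) + (\<Sum>(x, K)\<in>q. norm (\<Delta> K))"
        using \<open>finite p\<close> unfolding q_def len[symmetric] 
        by (simp add: case_prod_unfold sum.distrib sum_distrib_left sum.inter_filter)
      also have "(\<Sum>(x, K)\<in>q. norm (\<Delta> K)) < e / 2"
      proof -
        have ne: "K \<noteq> {}" if "(x, K) \<in> q" for x K
          using tagged_partial_division_ofD(2)[OF q that] by auto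
        \<comment> \<open>\<open>Sup {}\<close> and \<open>Inf {}\<close> are unspecified reals, so the empty interval needs the value 0 by hand\<close>
        define h where "h K = (if K = {} then 0 else norm (\<Delta> K))" for K
        have "(\<Sum>(x, K)\<in>q. norm (\<Delta> K)) = (\<Sum>(x, K)\<in>q. h K)"
          by (rule sum.cong) (auto simp: h_def dest: ne)
        also have "\<dots> = (\<Sum>K\<in>snd ` q. h K)"
        proof (rule sum.over_tagged_division_lemma)
          show "q tagged_division_of \<Union> (snd ` q)"
            using q unfolding tagged_division_of_def tagged_partial_division_of_def
            by (auto; force)
          fix u v :: real assume "box u v = {}"
          then have "v \<le> u" by simp
          then show "h (cbox u v) = 0" by (cases "u = v") (auto simp: h_def \<Delta>_def)
        qed
        also have "\<dots> = (\<Sum>K\<in>snd ` q. norm (\<Delta> K))"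
          by (rule sum.cong) (auto simp: h_def dest: ne)
        also have "\<dots> < e / 2"
          unfolding \<Delta>_def
        proof (rule \<delta>[rule_format], intro conjI)
          show div: "snd ` q division_of \<Union> (snd ` q)" by (rule partial_division_of_tagged_division[OF q])
          show "\<Union> (snd ` q) \<subseteq> {a..b}" using tagged_partial_division_ofD(3)[OF q] by fastforce
          have "\<Union> (snd ` q) \<subseteq> U" using fine by (fastforce simp: fine_def \<gamma>_def q_def)
          from sum_lengths_division_le_measure[OF div this U(3)]
          show "(\<Sum>K\<in>snd ` q. Sup K - Inf K) < \<delta>" using U(4) by simp
        qed
        finally show ?thesis .
      qed
      finally show ?thesis using \<eta> by linarith
    qed
    ultimately show "\<exists>\<gamma>. gauge \<gamma> \<and> (\<forall>\<D>. \<D> tagged_division_of {a..b} \<and> \<gamma> fine \<D> \<longrightarrow>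
        norm ((\<Sum>(x, k)\<in>\<D>. measure lborel k *\<^sub>R G x) - (F b - F a)) < e)"
      by (intro exI[of _ \<gamma>]) blast
  qed
  then show ?thesis
    by (rule has_integral_spike[OF E, rotated]) (simp add: G_def)
qed

lemma abs_continuous_imp_continuous_on:
  assumes "abs_continuous_on_interval a b F"
  shows "continuous_on {a..b} F"
  unfolding continuous_on_iff
proof (intro ballI allI impI)
  fix x e :: real assume x: "x \<in> {a..b}" and "e > 0"
  obtain \<delta> where "\<delta> > 0" and \<delta>:
    "\<forall>d S. d division_of S \<and> S \<subseteq> {a..b} \<and> (\<Sum>K\<in>d. Sup K - Inf K) < \<delta> \<longrightarrow>
        (\<Sum>K\<in>d. norm (F (Sup K) - F (Inf K))) < e"
    using assms \<open>e > 0\<close> unfolding abs_continuous_on_interval_def by blast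
  have *: "norm (F v - F u) < e" if "u \<le> v" "u \<in> {a..b}" "v \<in> {a..b}" "v - u < \<delta>" for u v
    using \<delta>[rule_format, of "{{u..v}}" "{u..v}"] that division_of_self[of u v] by auto
  have "dist (F y) (F x) < e" if "y \<in> {a..b}" "dist y x < \<delta>" for y
  proof (cases "x \<le> y")
    case True
    then show ?thesis using *[of x y] that x by (auto simp: dist_norm)
  next
    case False
    then show ?thesis using *[of y x] that x by (auto simp: dist_norm norm_minus_commute)
  qed
  then show "\<exists>d>0. \<forall>x'\<in>{a..b}. dist x' x < d \<longrightarrow> dist (F x') (F x) < e"
    using \<open>\<delta> > 0\<close> by blast
qed

text \<open>
  Both factors are bounded, and an increment of the product is
  \<open>(F v - F u) \<bullet> G v + F u \<bullet> (G v - G u)\<close>: the first part is controlled by absolute continuity of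
  \<open>F\<close>, the second by the length of the interval.
\<close>

lemma abs_continuous_on_interval_inner_lipschitz:
  fixes F G :: "real \<Rightarrow> 'a::real_inner"
  assumes F: "abs_continuous_on_interval a b F" and G: "L-lipschitz_on {a..b} G"
  shows "abs_continuous_on_interval a b (\<lambda>t. F t \<bullet> G t)"
proof -
  have "compact (F ` {a..b})" "compact (G ` {a..b})"
    using abs_continuous_imp_continuous_on[OF F] lipschitz_on_continuous_on[OF G]
    by (auto intro: compact_continuous_image)
  then obtain A B where "A > 0" "B > 0" and A: "\<And>t. t \<in> {a..b} \<Longrightarrow> norm (F t) \<le> A"
    and B: "\<And>t. t \<in> {a..b} \<Longrightarrow> norm (G t) \<le> B"
    by (metis bounded_pos compact_imp_bounded imageI)
  have "L \<ge> 0" using G by (rule lipschitz_on_nonneg)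
  show ?thesis
    unfolding abs_continuous_on_interval_def
  proof (intro allI impI)
    fix e :: real assume "e > 0"
    then have "e / (2 * B) > 0" using \<open>B > 0\<close> by simp
    then obtain \<delta> where "\<delta> > 0" and \<delta>:
      "\<forall>d S. d division_of S \<and> S \<subseteq> {a..b} \<and> (\<Sum>K\<in>d. Sup K - Inf K) < \<delta> \<longrightarrow>
        (\<Sum>K\<in>d. norm (F (Sup K) - F (Inf K))) < e / (2 * B)"
      using F unfolding abs_continuous_on_interval_def by blast
    \<comment> \<open>the summand 1 keeps the denominator positive when \<open>L = 0\<close>\<close>
    define \<delta>' where "\<delta>' = min \<delta> (e / (2 * (A * L + 1)))"
    have AL: "A * L + 1 > 0" using \<open>A > 0\<close> \<open>L \<ge> 0\<close> by (simp add: add_nonneg_pos)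
    have "\<delta>' > 0" using \<open>\<delta> > 0\<close> \<open>e > 0\<close> AL by (simp add: \<delta>'_def)
    moreover have "(\<Sum>K\<in>d. norm (F (Sup K) \<bullet> G (Sup K) - F (Inf K) \<bullet> G (Inf K))) < e"
      if d: "d division_of S" "S \<subseteq> {a..b}" "(\<Sum>K\<in>d. Sup K - Inf K) < \<delta>'" for d S
    proof -
      have "norm (F (Sup K) \<bullet> G (Sup K) - F (Inf K) \<bullet> G (Inf K))
          \<le> B * norm (F (Sup K) - F (Inf K)) + A * L * (Sup K - Inf K)" if K: "K \<in> d" for K
      proof -
        obtain u v where Kuv: "K = {u..v}" "u \<le> v"
          using division_ofD(3,4)[OF d(1) K] by auto
        have "K \<subseteq> {a..b}" using division_ofD(2)[OF d(1) K] d(2) by blast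
        with Kuv have uv: "u \<in> {a..b}" "v \<in> {a..b}" by auto
        have "F v \<bullet> G v - F u \<bullet> G u = (F v - F u) \<bullet> G v + F u \<bullet> (G v - G u)"
          by (simp add: inner_diff_left inner_diff_right)
        also have "norm \<dots> \<le> norm (F v - F u) * norm (G v) + norm (F u) * norm (G v - G u)"
          by (intro norm_triangle_le add_mono) (simp_all add: Cauchy_Schwarz_ineq2)
        also have "\<dots> \<le> norm (F v - F u) * B + A * (L * (v - u))"
          using lipschitz_onD[OF G uv(2,1)] Kuv(2) \<open>A > 0\<close>
          by (intro add_mono mult_mono A B uv) (auto simp: dist_norm)
        finally show ?thesis using Kuv by (simp add: mult_ac)
      qed
      then have "(\<Sum>K\<in>d. norm (F (Sup K) \<bullet> G (Sup K) - F (Inf K) \<bullet> G (Inf K)))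
          \<le> (\<Sum>K\<in>d. B * norm (F (Sup K) - F (Inf K)) + A * L * (Sup K - Inf K))"
        by (rule sum_mono)
      also have "\<dots> = B * (\<Sum>K\<in>d. norm (F (Sup K) - F (Inf K))) + A * L * (\<Sum>K\<in>d. Sup K - Inf K)"
        by (simp add: sum.distrib sum_distrib_left)
      also have "\<dots> < e / 2 + e / 2"
      proof (rule add_less_le_mono)
        have "(\<Sum>K\<in>d. norm (F (Sup K) - F (Inf K))) < e / (2 * B)"
          using d by (intro \<delta>[rule_format, of d S]) (auto simp: \<delta>'_def)
        then show "B * (\<Sum>K\<in>d. norm (F (Sup K) - F (Inf K))) < e / 2"
          using \<open>B > 0\<close> by (simp add: field_simps)
        have "A * L * (\<Sum>K\<in>d. Sup K - Inf K) \<le> A * L * (e / (2 * (A * L + 1)))"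
          using d \<open>A > 0\<close> \<open>L \<ge> 0\<close> by (intro mult_left_mono) (auto simp: \<delta>'_def)
        also have "\<dots> \<le> e / 2" using AL \<open>e > 0\<close> by (simp add: field_simps)
        finally show "A * L * (\<Sum>K\<in>d. Sup K - Inf K) \<le> e / 2" .
      qed
      finally show ?thesis by simp
    qed
    ultimately show "\<exists>\<delta>>0. \<forall>d S. d division_of S \<and> S \<subseteq> {a..b} \<and> (\<Sum>K\<in>d. Sup K - Inf K) < \<delta> \<longrightarrow>
        (\<Sum>K\<in>d. norm (F (Sup K) \<bullet> G (Sup K) - F (Inf K) \<bullet> G (Inf K))) < e" by blast
  qed
qed

section \<open>Exact linearization of the right-hand sides\<close>

lemma bounded_bilinear_matrix_vector_mult:
  "bounded_bilinear (\<lambda>(A::real^'n^'m) x. A *v x)"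
  by (auto simp: bilinear_conv_bounded_bilinear[symmetric] bilinear_def linear_iff
      matrix_vector_mult_add_rdistrib matrix_vector_right_distrib matrix_vector_mult_scaleR
      scaleR_matrix_vector_assoc)

text \<open>
  The bridge from continuity of a Jacobian as a matrix to continuity in operator norm, which is
  the form needed to combine partial derivatives into a joint one.
\<close>

lemma bounded_linear_matrix_to_blinfun:
  "bounded_linear (\<lambda>A::real^'n^'m. Blinfun ((*v) A))"
  unfolding linear_conv_bounded_linear[symmetric] linear_iff
  by (auto intro!: blinfun_eqI simp: bounded_linear_Blinfun_apply plus_blinfun.rep_eq scaleR_blinfun.rep_eq
      matrix_vector_mult_add_rdistrib scaleR_matrix_vector_assoc)

lemma continuous_on_compose_three:
  assumes "continuous_on \<Omega> (\<lambda>(u, v, t). M u v t)"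
    and "continuous_on S \<alpha>" "continuous_on S \<beta>" "continuous_on S \<tau>"
    and "\<And>x. x \<in> S \<Longrightarrow> (\<alpha> x, \<beta> x, \<tau> x) \<in> \<Omega>"
  shows "continuous_on S (\<lambda>x. M (\<alpha> x) (\<beta> x) (\<tau> x))"
  using continuous_on_compose2[OF assms(1), of S "\<lambda>x. (\<alpha> x, \<beta> x, \<tau> x)"] assms(2-)
  by (fastforce intro: continuous_on_Pair)

lemma open_time_slice:
  assumes "dae_domain T \<Omega>" "t \<in> {0..T}"
  shows "open {(u, v). (u, v, t) \<in> \<Omega>}"
proof -
  obtain S where S: "open S" "\<Omega> = (UNIV \<times> UNIV \<times> {0..T}) \<inter> S"
    using assms(1) unfolding dae_domain_def openin_open by auto
  have "{(u, v). (u, v, t) \<in> \<Omega>} = (\<lambda>p. (fst p, snd p, t)) -` S"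
    using S(2) assms(2) by auto
  moreover have "open ((\<lambda>p. (fst p, snd p, t)) -` S)"
    by (intro open_vimage S(1) continuous_intros)
  ultimately show ?thesis by simp
qed

text \<open>
  Separate differentiability in \<open>y\<close> and in \<open>z\<close> gives joint differentiability because the partial
  derivatives are continuous. The time slice of \<open>\<Omega>\<close> is open, so a box around \<open>(u, v)\<close> is available
  on which this can be carried out.
\<close>

lemma smooth_rhs_has_derivative:
  fixes F :: "real^'n \<Rightarrow> real^'m \<Rightarrow> real \<Rightarrow> real^'k"
  assumes \<Omega>: "dae_domain T \<Omega>" and F: "smooth_rhs \<Omega> F"
    and p: "(u, v, t) \<in> \<Omega>" and t: "t \<in> {0..T}"
  shows "((\<lambda>(u, v). F u v t) has_derivative
            (\<lambda>(h, k). partial_y F u v t *v h + partial_z F u v t *v k)) (at (u, v))"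
proof -
  have "open {(u, v). (u, v, t) \<in> \<Omega>}" by (rule open_time_slice[OF \<Omega> t])
  then obtain A B where AB: "open A" "open B" "(u, v) \<in> A \<times> B" "A \<times> B \<subseteq> {(u, v). (u, v, t) \<in> \<Omega>}"
    by (rule open_prod_elim[where x = "(u, v)"]) (use p in auto)
  obtain r where r: "r > 0" "ball v r \<subseteq> B" by (rule openE[OF AB(2), of v]) (use AB(3) in auto)
  define X Y where "X = A" and "Y = ball v r"
  have XY: "open (X \<times> Y)" "(u, v) \<in> X \<times> Y"
    using AB r by (auto simp: X_def Y_def open_Times)
  have in\<Omega>: "(x, y, t) \<in> \<Omega>" if "x \<in> X" "y \<in> Y" for x y
    using AB(4) r(2) that unfolding X_def Y_def by blast
  have diff: "(\<lambda>u'. F u' y t) differentiable (at x)" "(\<lambda>v'. F x v' t) differentiable (at y)"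
    if "(x, y, t) \<in> \<Omega>" for x y using F that unfolding smooth_rhs_def by auto
  have "continuous_on \<Omega> (\<lambda>(u, v, t). partial_z F u v t)"
    using F unfolding smooth_rhs_def by blast
  then have "continuous_on (X \<times> Y) (\<lambda>p. partial_z F (fst p) (snd p) t)"
    by (rule continuous_on_compose_three) (auto intro!: continuous_intros in\<Omega>)
  then have "continuous_on (X \<times> Y) (\<lambda>p. Blinfun ((*v) (partial_z F (fst p) (snd p) t)))"
    by (intro bounded_linear.continuous_on[OF bounded_linear_matrix_to_blinfun])
  then have cont: "continuous (at (u, v) within X \<times> Y) (\<lambda>(x, y). Blinfun ((*v) (partial_z F x y t)))"
    using XY(2) by (simp add: continuous_on_eq_continuous_within case_prod_unfold)
  have "((\<lambda>(x, y). F x y t) has_derivative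
          (\<lambda>(h, k). partial_y F u v t *v h + blinfun_apply (Blinfun ((*v) (partial_z F u v t))) k))
        (at (u, v) within X \<times> Y)"
  proof (rule has_derivative_partialsI[OF _ _ cont])
    show "((\<lambda>x. F x v t) has_derivative (*v) (partial_y F u v t)) (at u within X)"
      using diff(1)[OF p] unfolding jacobian_works partial_y_def by (rule has_derivative_at_withinI)
    show "((\<lambda>y. F x y t) has_derivative blinfun_apply (Blinfun ((*v) (partial_z F x y t)))) (at y within Y)"
      if "x \<in> X" "y \<in> Y" for x y
      using diff(2)[OF in\<Omega>[OF that]] unfolding jacobian_works partial_z_def[symmetric]
      by (simp add: bounded_linear_Blinfun_apply has_derivative_at_withinI)
  qed (use r in \<open>auto simp: Y_def\<close>)
  then show ?thesis
    using at_within_open[OF XY(2,1)] by (simp add: bounded_linear_Blinfun_apply)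
qed

text \<open>
  Mean value theorem in integral form: integrate the derivative of \<open>F\<close> along the segment from
  \<open>(Y t, Z t)\<close> to \<open>(y t, z t)\<close>. The direction of the segment is constant, so it leaves the
  integral, and what remains are the averaged Jacobians. This is why averages, not Jacobians at a
  point, must appear in the adjoint problem for the error formula to be exact.
\<close>

lemma rhs_diff_eq_avg_mult:
  fixes F :: "real^'n \<Rightarrow> real^'m \<Rightarrow> real \<Rightarrow> real^'k"
  assumes \<Omega>: "dae_domain T \<Omega>" and F: "smooth_rhs \<Omega> F" and seg: "segment_in T \<Omega> y z Y Z"
    and t: "t \<in> {0..T}"
  shows "F (y t) (z t) t - F (Y t) (Z t) t
       = avg_y F y z Y Z t *v (y t - Y t) + avg_z F y z Y Z t *v (z t - Z t)"
proof -
  define a b where "a = y t - Y t" and "b = z t - Z t"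
  define \<gamma> where "\<gamma> s = (Y t + s *\<^sub>R a, Z t + s *\<^sub>R b)" for s
  have \<gamma>: "\<gamma> s = (s *\<^sub>R y t + (1 - s) *\<^sub>R Y t, s *\<^sub>R z t + (1 - s) *\<^sub>R Z t)" for s
    by (simp add: \<gamma>_def a_def b_def algebra_simps)
  define A where "A = (\<lambda>s. partial_y F (fst (\<gamma> s)) (snd (\<gamma> s)) t)"
  define B where "B = (\<lambda>s. partial_z F (fst (\<gamma> s)) (snd (\<gamma> s)) t)"
  have in\<Omega>: "(fst (\<gamma> s), snd (\<gamma> s), t) \<in> \<Omega>" if "s \<in> {0..1}" for s
    using seg t that by (auto simp: \<gamma> segment_in_def)
  have "continuous_on {0..1} A" "continuous_on {0..1} B"
    using F in\<Omega> unfolding smooth_rhs_def A_def B_def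
    by (auto intro!: continuous_on_compose_three[where \<Omega> = \<Omega>] continuous_intros simp: \<gamma>_def)
  then have int: "A integrable_on {0..1}" "B integrable_on {0..1}"
    by (auto intro!: integrable_continuous_interval)
  have "((\<lambda>s. A s *v a + B s *v b) has_integral
      (\<lambda>(u, v). F u v t) (\<gamma> 1) - (\<lambda>(u, v). F u v t) (\<gamma> 0)) {0..1}"
  proof (rule fundamental_theorem_of_calculus)
    fix s :: real assume s: "s \<in> {0..1}"
    have "(\<gamma> has_derivative (\<lambda>h. h *\<^sub>R (a, b))) (at s within {0..1})"
      unfolding \<gamma>_def by (auto intro!: derivative_eq_intros)
    moreover have "((\<lambda>(u, v). F u v t) has_derivative (\<lambda>(h, k). A s *v h + B s *v k)) (at (\<gamma> s))"
      using smooth_rhs_has_derivative[OF \<Omega> F in\<Omega>[OF s] t] by (simp add: A_def B_def)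
    ultimately have "((\<lambda>s. (\<lambda>(u, v). F u v t) (\<gamma> s)) has_derivative
        (\<lambda>h. (\<lambda>(h, k). A s *v h + B s *v k) (h *\<^sub>R (a, b)))) (at s within {0..1})"
      by (rule has_derivative_compose)
    then show "((\<lambda>s. (\<lambda>(u, v). F u v t) (\<gamma> s)) has_vector_derivative A s *v a + B s *v b)
        (at s within {0..1})"
      by (simp add: has_vector_derivative_def matrix_vector_mult_scaleR scaleR_add_right)
  qed simp
  moreover have "((\<lambda>s. A s *v a + B s *v b) has_integral
      integral {0..1} A *v a + integral {0..1} B *v b) {0..1}"
    using has_integral_linear[OF integrable_integral[OF int(1)]
          bounded_bilinear.bounded_linear_left[OF bounded_bilinear_matrix_vector_mult, of a]]
      has_integral_linear[OF integrable_integral[OF int(2)]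
          bounded_bilinear.bounded_linear_left[OF bounded_bilinear_matrix_vector_mult, of b]]
    by (auto intro!: has_integral_add simp: o_def)
  ultimately have "(\<lambda>(u, v). F u v t) (\<gamma> 1) - (\<lambda>(u, v). F u v t) (\<gamma> 0)
      = integral {0..1} A *v a + integral {0..1} B *v b"
    by (rule has_integral_unique)
  then show ?thesis
    by (simp add: avg_y_def avg_z_def A_def B_def \<gamma> a_def b_def)
qed

section \<open>Piecewise linear interpolants and integrability\<close>

lemma Icc_subset_Union_grid:
  assumes "N \<ge> 1" "c \<ge> 0"
  shows "{0..real N * c} \<subseteq> (\<Union>k<N. {real k * c..real (Suc k) * c})"
  using assms(1)
proof (induction N rule: nat_induct_at_least)
  case (Suc N)
  have "{0..real (Suc N) * c} \<subseteq> {0..real N * c} \<union> {real N * c..real (Suc N) * c}" by auto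
  also have "\<dots> \<subseteq> (\<Union>k<Suc N. {real k * c..real (Suc k) * c})"
    using Suc.IH by (auto simp: lessThan_Suc)
  finally show ?case .
qed (simp add: lessThan_Suc)

context
  fixes T :: real and N :: nat and Xn :: "nat \<Rightarrow> 'a::euclidean_space" and X :: "real \<Rightarrow> 'a"
  assumes T: "T > 0" and N: "N \<ge> 1" and X: "pw_linear_interpolant T N Xn X"
begin

lemma pw_linear_interpolant_has_vector_derivative:
  assumes "k < N" "t \<in> {real k * (T / N)<..<real (Suc k) * (T / N)}"
  shows "(X has_vector_derivative (Xn (Suc k) - Xn k) /\<^sub>R (T / N)) (at t)"
proof (rule has_vector_derivative_transform_within_open)
  show "((\<lambda>s. Xn k + ((s - real k * (T / N)) / (T / N)) *\<^sub>R (Xn (Suc k) - Xn k)) has_vector_derivative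
      (Xn (Suc k) - Xn k) /\<^sub>R (T / N)) (at t)"
    by (auto intro!: derivative_eq_intros simp: divide_inverse)
  show "Xn k + ((s - real k * (T / N)) / (T / N)) *\<^sub>R (Xn (Suc k) - Xn k) = X s"
    if "s \<in> {real k * (T / N)<..<real (Suc k) * (T / N)}" for s
    using X assms(1) that unfolding pw_linear_interpolant_def Let_def by force
qed (use assms in auto)

text \<open>
  The Lipschitz constant is the crudest one that serves all pieces at once: the sum of the norms
  of all slopes.
\<close>

lemma pw_linear_interpolant_lipschitz:
  "((\<Sum>k<N. norm (Xn (Suc k) - Xn k)) / (T / N))-lipschitz_on {0..T} X"
proof (rule lipschitz_on_closed_Union)
  let ?M = "(\<Sum>k<N. norm (Xn (Suc k) - Xn k)) / (T / N)"
  have dt: "T / N > 0" using T N by simp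
  show M0: "0 \<le> ?M" using dt by (intro divide_nonneg_pos sum_nonneg) auto
  show "?M-lipschitz_on {real k * (T / N)..real (Suc k) * (T / N)} X" if "k \<in> {..<N}" for k
  proof (rule lipschitz_onI)
    fix s t assume "s \<in> {real k * (T / N)..real (Suc k) * (T / N)}" "t \<in> {real k * (T / N)..real (Suc k) * (T / N)}"
    then have "X s - X t = ((s - t) / (T / N)) *\<^sub>R (Xn (Suc k) - Xn k)"
      using X that unfolding pw_linear_interpolant_def Let_def
      by (simp add: scaleR_diff_left[symmetric] diff_divide_distrib[symmetric] left_diff_distrib)
    then have "dist (X s) (X t) = norm (Xn (Suc k) - Xn k) / (T / N) * dist s t"
      using dt T by (simp add: dist_norm dist_real_def abs_mult)
    also have "\<dots> \<le> ?M * dist s t"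
      using that dt by (intro mult_right_mono divide_right_mono member_le_sum) auto
    finally show "dist (X s) (X t) \<le> ?M * dist s t" .
  qed (rule M0)
  show "{0..T} \<subseteq> (\<Union>k\<in>{..<N}. {real k * (T / N)..real (Suc k) * (T / N)})"
    using Icc_subset_Union_grid[OF N, of "T / N"] dt N by simp
qed auto

lemma pw_linear_interpolant_off_grid:
  assumes "t \<in> {0..T} - (\<lambda>k. real k * (T / N)) ` {..N}"
  obtains k where "k < N" "t \<in> {real k * (T / N)<..<real (Suc k) * (T / N)}"
proof -
  have "t \<in> {0..real N * (T / N)}" using assms N by simp
  then obtain k where k: "k < N" "t \<in> {real k * (T / N)..real (Suc k) * (T / N)}"
    using Icc_subset_Union_grid[OF N, of "T / N"] T by auto
  moreover have "t \<noteq> real k * (T / N)" "t \<noteq> real (Suc k) * (T / N)"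
    using assms k(1) by (auto simp del: of_nat_Suc)
  ultimately show thesis using that by (metis atLeastAtMost_iff greaterThanLessThan_iff order_less_le)
qed

lemma pw_linear_interpolant_vector_derivative:
  assumes "t \<in> {0..T} - (\<lambda>k. real k * (T / N)) ` {..N}"
  shows "(X has_vector_derivative vector_derivative X (at t within {0..T})) (at t)"
    and "norm (vector_derivative X (at t within {0..T})) \<le> (\<Sum>k<N. norm (Xn (Suc k) - Xn k)) / (T / N)"
proof -
  obtain k where k: "k < N" "t \<in> {real k * (T / N)<..<real (Suc k) * (T / N)}"
    using pw_linear_interpolant_off_grid[OF assms] by blast
  have vd: "vector_derivative X (at t within {0..T}) = (Xn (Suc k) - Xn k) /\<^sub>R (T / N)"
    using pw_linear_interpolant_has_vector_derivative[OF k] assms T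
    by (intro vector_derivative_at_within_ivl) auto
  show "(X has_vector_derivative vector_derivative X (at t within {0..T})) (at t)"
    using pw_linear_interpolant_has_vector_derivative[OF k] vd by simp
  have "norm ((Xn (Suc k) - Xn k) /\<^sub>R (T / N)) = norm (Xn (Suc k) - Xn k) / (T / N)"
    using T by (simp add: divide_inverse)
  also have "\<dots> \<le> (\<Sum>k<N. norm (Xn (Suc k) - Xn k)) / (T / N)"
    using k T by (intro divide_right_mono member_le_sum) auto
  finally show "norm (vector_derivative X (at t within {0..T})) \<le> (\<Sum>k<N. norm (Xn (Suc k) - Xn k)) / (T / N)"
    using vd by simp
qed

text \<open>
  At an interior grid point the interpolant may have a kink, and \<open>vector_derivative\<close> is then an
  unspecified value; being finite in number, these points do not affect integrability.
  Measurability comes for free from Henstock-Kurzweil integrability, and boundedness off the grid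
  then gives absolute integrability.
\<close>

lemma pw_linear_interpolant_derivative_absolutely_integrable:
  "(\<lambda>t. vector_derivative X (at t within {0..T})) absolutely_integrable_on {0..T}"
proof -
  define D where "D t = vector_derivative X (at t within {0..T})" for t
  define G where "G = (\<lambda>k. real k * (T / N)) ` {..N}"
  define M where "M = (\<Sum>k<N. norm (Xn (Suc k) - Xn k)) / (T / N)"
  have G: "finite G" by (simp add: G_def)
  have "M \<ge> 0" using T N unfolding M_def by (intro divide_nonneg_pos sum_nonneg) auto
  have D: "(X has_vector_derivative D t) (at t)" "norm (D t) \<le> M" if "t \<in> {0..T} - G" for t
    using pw_linear_interpolant_vector_derivative[of t] that unfolding D_def G_def M_def by blast+
  have "(D has_integral (X T - X 0)) {0..T}"
    using G T D(1) lipschitz_on_continuous_on[OF pw_linear_interpolant_lipschitz]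
    by (intro fundamental_theorem_of_calculus_interior_strong[where S = G]) auto
  then have "(\<lambda>t. if t \<in> G then 0 else D t) integrable_on {0..T}"
    by (intro integrable_spike[OF has_integral_integrable negligible_finite[OF G]]) auto
  then have "(\<lambda>t. if t \<in> G then 0 else D t) absolutely_integrable_on {0..T}"
    using D(2) \<open>M \<ge> 0\<close>
    by (intro measurable_bounded_by_integrable_imp_absolutely_integrable[where g = "\<lambda>_. M"]
        integrable_imp_measurable) auto
  then have "D absolutely_integrable_on {0..T}"
    by (rule absolutely_integrable_spike[OF _ negligible_finite[OF G]]) auto
  then show ?thesis unfolding D_def .
qed

end

lemma AE_imp_off_negligible:
  assumes "AE t in lebesgue. t \<in> S \<longrightarrow> P t"
  obtains E where "negligible E" "\<And>t. t \<in> S - E \<Longrightarrow> P t"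
proof -
  obtain E where "E \<in> null_sets lebesgue" "{t \<in> space lebesgue. \<not> (t \<in> S \<longrightarrow> P t)} \<subseteq> E"
    using assms unfolding eventually_ae_filter by blast
  then show thesis by (intro that[of E]) (auto simp: negligible_iff_null_sets)
qed

text \<open>
  On a bounded interval square integrability is a form of integrability, since
  \<open>\<bar>x\<bar> \<le> 1 + x\<^sup>2\<close>.
\<close>

lemma L2_T_imp_absolutely_integrable:
  fixes a :: "real \<Rightarrow> 'a::euclidean_space"
  assumes "L2_T T a"
  shows "a absolutely_integrable_on {0..T}"
proof (rule measurable_bounded_by_integrable_imp_absolutely_integrable)
  show "a \<in> borel_measurable (lebesgue_on {0..T})"
    using assms by (simp add: L2_T_def set_borel_measurable_def borel_measurable_restrict_space_iff)
  show "(\<lambda>t. 1 + (norm (a t))\<^sup>2) integrable_on {0..T}"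
    using assms by (intro integrable_add integrable_const_ivl)
      (auto simp: L2_T_def intro: set_lebesgue_integral_eq_integral)
  show "norm (a t) \<le> 1 + (norm (a t))\<^sup>2" for t
    using sum_squares_bound[of 1 "norm (a t)"] norm_ge_zero[of "a t"] by (simp; linarith)
qed simp

lemma
  fixes f g :: "real \<Rightarrow> 'a::euclidean_space"
  assumes f: "continuous_on {0..T} f" and g: "g absolutely_integrable_on {0..T}"
  shows absolutely_integrable_continuous_inner: "(\<lambda>t. f t \<bullet> g t) absolutely_integrable_on {0..T}"
    and absolutely_integrable_inner_continuous: "(\<lambda>t. g t \<bullet> f t) absolutely_integrable_on {0..T}"
proof -
  have bil: "bilinear ((\<bullet>) :: 'a \<Rightarrow> _)"
    by (simp add: bilinear_conv_bounded_bilinear bounded_bilinear_inner)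
  have mb: "f \<in> borel_measurable (lebesgue_on {0..T})" "bounded (f ` {0..T})"
    using f by (auto intro: continuous_imp_measurable_on_sets_lebesgue compact_imp_bounded compact_continuous_image)
  show "(\<lambda>t. f t \<bullet> g t) absolutely_integrable_on {0..T}"
    by (rule absolutely_integrable_bounded_measurable_product[OF bil mb(1) _ mb(2) g]) simp
  then show "(\<lambda>t. g t \<bullet> f t) absolutely_integrable_on {0..T}" by (simp add: inner_commute)
qed

lemma continuous_vector_derivative_imp_lipschitz:
  fixes y :: "real \<Rightarrow> 'a::real_normed_vector"
  assumes "\<And>t. t \<in> {a..b} \<Longrightarrow> (y has_vector_derivative y' t) (at t within {a..b})"
    and "continuous_on {a..b} y'"
  obtains L where "L-lipschitz_on {a..b} y"
proof -
  obtain C where C: "C > 0" "\<And>t. t \<in> {a..b} \<Longrightarrow> norm (y' t) \<le> C"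
    using compact_imp_bounded[OF compact_continuous_image[OF assms(2) compact_Icc]]
    by (metis bounded_pos imageI)
  have "C-lipschitz_on {a..b} y"
  proof (rule bounded_derivative_imp_lipschitz)
    show "(y has_derivative (\<lambda>h. h *\<^sub>R y' t)) (at t within {a..b})" if "t \<in> {a..b}" for t
      using assms(1)[OF that] by (simp add: has_vector_derivative_def)
    show "onorm (\<lambda>h. h *\<^sub>R y' t) \<le> C" if "t \<in> {a..b}" for t
      using C(2)[OF that] by (intro onorm_le) (simp add: mult.commute[of C] mult_left_mono)
  qed (use C in auto)
  then show thesis by (rule that)
qed

section \<open>The error representation\<close>

theorem theorem3p2:
  fixes f :: "real^'n \<Rightarrow> real^'m \<Rightarrow> real \<Rightarrow> real^'n"
    and g :: "real^'n \<Rightarrow> real^'m \<Rightarrow> real \<Rightarrow> real^'m"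
    and \<Omega> :: "((real^'n) \<times> (real^'m) \<times> real) set"
    and y Y \<psi>y \<phi>y :: "real \<Rightarrow> real^'n"
    and z Z \<psi>z \<phi>z :: "real \<Rightarrow> real^'m"
    and Yn :: "nat \<Rightarrow> real^'n" and Zn :: "nat \<Rightarrow> real^'m"
    and T :: real and N :: nat
  assumes "T > 0" and "N \<ge> 1"
    and "dae_domain T \<Omega>" and "smooth_rhs \<Omega> f" and "smooth_rhs \<Omega> g"
    and "dae_solution T \<Omega> f g y z" and "index_1 T \<Omega> g y z"
    and "Yn 0 = y 0" and "Zn 0 = z 0" and "bdf1 T N f g Yn Zn"
    and "pw_linear_interpolant T N Yn Y" and "pw_linear_interpolant T N Zn Z"
    and "segment_in T \<Omega> y z Y Z"
    and "\<And>t. t \<in> {0..T} \<Longrightarrow> invertible (avg_z g y z Y Z t)"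
    and "L2_T T \<psi>y" and "L2_T T \<psi>z"
    and "adjoint_solution T f g y z Y Z \<psi>y \<psi>z \<phi>y \<phi>z"
  shows "qoi T \<psi>y \<psi>z y z - qoi T \<psi>y \<psi>z Y Z =
           ip_T T (\<lambda>t. y t - Y t) \<psi>y + ip_T T (\<lambda>t. z t - Z t) \<psi>z
       \<and> qoi T \<psi>y \<psi>z y z - qoi T \<psi>y \<psi>z Y Z =
           \<phi>y 0 \<bullet> (y 0 - Y 0)
         + ip_T T \<phi>y (\<lambda>t. f (Y t) (Z t) t - vector_derivative Y (at t within {0..T}))
         + ip_T T \<phi>z (\<lambda>t. g (Y t) (Z t) t)"
proof -
  note \<Omega> = \<open>dae_domain T \<Omega>\<close> and seg = \<open>segment_in T \<Omega> y z Y Z\<close>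
  define W where "W t = vector_derivative Y (at t within {0..T})" for t
  define G where "G = (\<lambda>k. real k * (T / N)) ` {..N}"
  have sol: "(y t, z t, t) \<in> \<Omega>" "(y has_vector_derivative f (y t) (z t) t) (at t within {0..T})"
      "g (y t) (z t) t = 0" if "t \<in> {0..T}" for t
    using \<open>dae_solution T \<Omega> f g y z\<close> that unfolding dae_solution_def by auto
  have adj: "abs_continuous_on_interval 0 T \<phi>y" "L2_T T \<phi>z" "\<phi>y T = 0"
      "AE t in lebesgue. t \<in> {0..<T} \<longrightarrow> (\<phi>y has_vector_derivative
           - (transpose (avg_y f y z Y Z t) *v \<phi>y t + transpose (avg_y g y z Y Z t) *v \<phi>z t + \<psi>y t))
          (at t within {0..T})"
      "AE t in lebesgue. t \<in> {0..<T} \<longrightarrow>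
        0 = transpose (avg_z f y z Y Z t) *v \<phi>y t + transpose (avg_z g y z Y Z t) *v \<phi>z t + \<psi>z t"
    using assms(17) unfolding adjoint_solution_def by auto
  have inY: "(Y t, Z t, t) \<in> \<Omega>" if "t \<in> {0..T}" for t
    using seg that unfolding segment_in_def by force

  obtain LY where LY: "LY-lipschitz_on {0..T} Y"
    using pw_linear_interpolant_lipschitz[OF assms(1,2,11)] by blast
  have cy: "continuous_on {0..T} y"
    using sol(2) by (meson has_vector_derivative_continuous continuous_on_eq_continuous_within)
  have cz: "continuous_on {0..T} z" using assms(6) unfolding dae_solution_def by auto
  have cY: "continuous_on {0..T} Y" by (rule lipschitz_on_continuous_on[OF LY])
  have cZ: "continuous_on {0..T} Z"
    by (rule lipschitz_on_continuous_on[OF pw_linear_interpolant_lipschitz[OF assms(1,2,12)]])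
  have c\<phi>: "continuous_on {0..T} \<phi>y" by (rule abs_continuous_imp_continuous_on[OF adj(1)])
  have cf\<Omega>: "continuous_on \<Omega> (\<lambda>(u, v, t). f u v t)" and cg\<Omega>: "continuous_on \<Omega> (\<lambda>(u, v, t). g u v t)"
    using assms(4,5) unfolding smooth_rhs_def by blast+
  have cf: "continuous_on {0..T} (\<lambda>t. f (y t) (z t) t)" "continuous_on {0..T} (\<lambda>t. f (Y t) (Z t) t)"
    by (intro continuous_on_compose_three[OF cf\<Omega>] continuous_on_id cy cz cY cZ sol(1) inY; assumption)+
  have cg: "continuous_on {0..T} (\<lambda>t. g (Y t) (Z t) t)"
    by (intro continuous_on_compose_three[OF cg\<Omega>] continuous_on_id cY cZ inY)
  obtain Ly where "Ly-lipschitz_on {0..T} y"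
    using continuous_vector_derivative_imp_lipschitz[OF sol(2) cf(1)] by blast
  then have Le: "(Ly + LY)-lipschitz_on {0..T} (\<lambda>t. y t - Y t)"
    by (rule lipschitz_on_diff) (rule LY)

  note \<psi>y = L2_T_imp_absolutely_integrable[OF assms(15)]
    and \<psi>z = L2_T_imp_absolutely_integrable[OF assms(16)]
    and \<phi>z = L2_T_imp_absolutely_integrable[OF adj(2)]
  have W: "W absolutely_integrable_on {0..T}"
    unfolding W_def by (rule pw_linear_interpolant_derivative_absolutely_integrable[OF assms(1,2,11)])
  have "continuous_on {0..T} (\<lambda>t. y t - Y t)" "continuous_on {0..T} (\<lambda>t. z t - Z t)"
    by (intro continuous_intros cy cY cz cZ)+
  then have ai_e: "(\<lambda>t. (y t - Y t) \<bullet> \<psi>y t) absolutely_integrable_on {0..T}"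
    "(\<lambda>t. (z t - Z t) \<bullet> \<psi>z t) absolutely_integrable_on {0..T}"
    by (auto intro: absolutely_integrable_continuous_inner \<psi>y \<psi>z)
  have "(\<lambda>t. f (Y t) (Z t) t - W t) absolutely_integrable_on {0..T}"
    by (intro set_integral_diff W absolutely_integrable_continuous_real cf(2))
  then have ai_r: "(\<lambda>t. \<phi>y t \<bullet> (f (Y t) (Z t) t - W t)) absolutely_integrable_on {0..T}"
    "(\<lambda>t. \<phi>z t \<bullet> g (Y t) (Z t) t) absolutely_integrable_on {0..T}"
    by (auto intro: absolutely_integrable_continuous_inner c\<phi> absolutely_integrable_inner_continuous cg \<phi>z)

  obtain E1 where E1: "negligible E1"
    "\<And>t. t \<in> {0..<T} - E1 \<Longrightarrow> (\<phi>y has_vector_derivative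
       - (transpose (avg_y f y z Y Z t) *v \<phi>y t + transpose (avg_y g y z Y Z t) *v \<phi>z t + \<psi>y t))
          (at t within {0..T})"
    using AE_imp_off_negligible[OF adj(4)] by blast
  obtain E2 where E2: "negligible E2"
    "\<And>t. t \<in> {0..<T} - E2 \<Longrightarrow>
       0 = transpose (avg_z f y z Y Z t) *v \<phi>y t + transpose (avg_z g y z Y Z t) *v \<phi>z t + \<psi>z t"
    using AE_imp_off_negligible[OF adj(5)] by blast
  \<comment> \<open>what the almost-everywhere derivative of \<open>\<phi>y \<bullet> (y - Y)\<close> becomes once every averaged Jacobian
    has cancelled\<close>
  define R where "R t = \<phi>y t \<bullet> (f (Y t) (Z t) t - W t) + \<phi>z t \<bullet> g (Y t) (Z t) t
      - (y t - Y t) \<bullet> \<psi>y t - (z t - Z t) \<bullet> \<psi>z t" for t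
  have "(R has_integral \<phi>y T \<bullet> (y T - Y T) - \<phi>y 0 \<bullet> (y 0 - Y 0)) {0..T}"
  proof (rule fundamental_theorem_of_calculus_abs_continuous)
    show "abs_continuous_on_interval 0 T (\<lambda>t. \<phi>y t \<bullet> (y t - Y t))"
      by (rule abs_continuous_on_interval_inner_lipschitz[OF adj(1) Le])
    show "negligible (E1 \<union> E2 \<union> G \<union> {T})"
      using E1(1) E2(1) by (auto simp: G_def)
    fix t assume t: "t \<in> {0..T} - (E1 \<union> E2 \<union> G \<union> {T})"
    then have tT: "t \<in> {0..T}" and t1: "t \<in> {0..<T} - E1" and t2: "t \<in> {0..<T} - E2" by auto
    have "(Y has_vector_derivative W t) (at t within {0..T})"
      unfolding W_def
      by (rule has_vector_derivative_at_within,
          rule pw_linear_interpolant_vector_derivative(1)[OF assms(1,2,11)]) (use t in \<open>auto simp: G_def\<close>)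
    then have e': "((\<lambda>t. y t - Y t) has_vector_derivative f (y t) (z t) t - W t) (at t within {0..T})"
      by (intro has_vector_derivative_diff sol(2) tT)
    define ey ez where "ey = y t - Y t" and "ez = z t - Z t"
    have mv: "f (y t) (z t) t = f (Y t) (Z t) t + (avg_y f y z Y Z t *v ey + avg_z f y z Y Z t *v ez)"
      "g (Y t) (Z t) t = - (avg_y g y z Y Z t *v ey + avg_z g y z Y Z t *v ez)"
      using rhs_diff_eq_avg_mult[OF \<Omega> assms(4) seg tT] rhs_diff_eq_avg_mult[OF \<Omega> assms(5) seg tT]
        sol(3)[OF tT] unfolding ey_def ez_def by (simp_all add: algebra_simps)
    have alg: "\<psi>z t = - (transpose (avg_z f y z Y Z t) *v \<phi>y t + transpose (avg_z g y z Y Z t) *v \<phi>z t)"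
      using E2(2)[OF t2] by (metis add.commute eq_neg_iff_add_eq_0)
    \<comment> \<open>the terms with \<open>avg_y f\<close> cancel between the two summands; those with \<open>avg_y g\<close> and \<open>avg_z g\<close>
      add up to the residual of \<open>g\<close>, and the algebraic adjoint equation trades \<open>avg_z f\<close> for \<open>\<psi>z\<close>\<close>
    have "\<phi>y t \<bullet> (f (y t) (z t) t - W t)
        + (- (transpose (avg_y f y z Y Z t) *v \<phi>y t + transpose (avg_y g y z Y Z t) *v \<phi>z t + \<psi>y t)) \<bullet> ey
        = R t"
      unfolding R_def alg mv ey_def[symmetric] ez_def[symmetric]
      by (simp add: inner_add_left inner_add_right inner_diff_left inner_diff_right dot_lmul_matrix
          inner_commute[of ey] inner_commute[of ez])
    then show "((\<lambda>t. \<phi>y t \<bullet> (y t - Y t)) has_vector_derivative R t) (at t within {0..T})"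
      using bounded_bilinear.has_vector_derivative[OF bounded_bilinear_inner E1(2)[OF t1] e'] by (simp add: ey_def)
  qed (use assms(1) in auto)
  moreover have "(R has_integral
      ip_T T \<phi>y (\<lambda>t. f (Y t) (Z t) t - W t) + ip_T T \<phi>z (\<lambda>t. g (Y t) (Z t) t)
      - ip_T T (\<lambda>t. y t - Y t) \<psi>y - ip_T T (\<lambda>t. z t - Z t) \<psi>z) {0..T}"
    unfolding R_def ip_T_def
    by (intro has_integral_add has_integral_diff has_integral_set_lebesgue ai_e ai_r)
  ultimately have "\<phi>y T \<bullet> (y T - Y T) - \<phi>y 0 \<bullet> (y 0 - Y 0)
      = ip_T T \<phi>y (\<lambda>t. f (Y t) (Z t) t - W t) + ip_T T \<phi>z (\<lambda>t. g (Y t) (Z t) t)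
        - ip_T T (\<lambda>t. y t - Y t) \<psi>y - ip_T T (\<lambda>t. z t - Z t) \<psi>z"
    by (rule has_integral_unique)
  then have rep: "ip_T T (\<lambda>t. y t - Y t) \<psi>y + ip_T T (\<lambda>t. z t - Z t) \<psi>z
      = \<phi>y 0 \<bullet> (y 0 - Y 0) + ip_T T \<phi>y (\<lambda>t. f (Y t) (Z t) t - W t) + ip_T T \<phi>z (\<lambda>t. g (Y t) (Z t) t)"
    unfolding adj(3) by simp
  have "ip_T T (\<lambda>t. y t - Y t) \<psi>y = ip_T T y \<psi>y - ip_T T Y \<psi>y"
    "ip_T T (\<lambda>t. z t - Z t) \<psi>z = ip_T T z \<psi>z - ip_T T Z \<psi>z"
    unfolding ip_T_def inner_diff_left
    by (intro set_integral_diff absolutely_integrable_continuous_inner cy cY cz cZ \<psi>y \<psi>z)+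
  with rep show ?thesis by (simp add: qoi_def W_def)
qed

end
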